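(* Let $n\ge 1$ be an integer and let $K_n$ be the complete graph on $n$ vertices. If $n\neq 1,4$, then the harmonious total chromatic number of $K_n$ is $$h_t(K_n)=\left\lceil \tfrac{3}{2}n\right\rceil,$$ while $h_t(K_1)=1$ and $h_t(K_4)=7$.
   Context: Graphs are finite and simple. A total colouring of a graph $G$ is an assignment of colours to both the vertices and the edges of $G$ (from a common set of colours) such that adjacent vertices receive different colours, adjacent edges (distinct edges sharing an endpoint) receive different colours, and every edge receives a colour different from the colours of its end vertices. A harmonious total colouring of $G$ is a total colouring $c$ with the additional property that, when for each incident pair $(v,e)$ of a vertex $v$ and an edge $e$ one writes the unordered pair of colours $\{c(v),c(e)\}$, each unordered pair of colours occurs at most once; that is, for distinct incident pairs $(v,e)\ne(w,f)$ one has $\{c(v),c(e)\}\neq\{c(w),c(f)\}$. The harmonious total chromatic number $h_t(G)$ is the smallest number of colours in a harmonious total colouring of $G$. *)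

theory Defs
  imports Complex_Main
begin

text \<open>A finite simple graph is given by its vertex set \<open>V\<close> and its set \<open>E\<close> of edges,
  each edge being a two-element subset of \<open>V\<close>.\<close>

definition simple_graph :: "'a set \<Rightarrow> 'a set set \<Rightarrow> bool" where
  "simple_graph V E \<longleftrightarrow> finite V \<and> (\<forall>e\<in>E. e \<subseteq> V \<and> card e = 2)"

definition complete_verts :: "nat \<Rightarrow> nat set" where
  "complete_verts n = {..<n}"

definition complete_edges :: "nat \<Rightarrow> nat set set" where
  "complete_edges n = {e. e \<subseteq> complete_verts n \<and> card e = 2}"

text \<open>A colouring is a single function on the disjoint sum of vertices (\<open>Inl v\<close>) and edges
  (\<open>Inr e\<close>); its values outside \<open>V <+> E\<close> are irrelevant.\<close>

definition total_colouring :: "'a set \<Rightarrow> 'a set set \<Rightarrow> ('a + 'a set \<Rightarrow> 'c) \<Rightarrow> bool" where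
  "total_colouring V E c \<longleftrightarrow>
     (\<forall>u\<in>V. \<forall>v\<in>V. {u, v} \<in> E \<longrightarrow> c (Inl u) \<noteq> c (Inl v)) \<and>
     (\<forall>e\<in>E. \<forall>f\<in>E. e \<noteq> f \<and> e \<inter> f \<noteq> {} \<longrightarrow> c (Inr e) \<noteq> c (Inr f)) \<and>
     (\<forall>e\<in>E. \<forall>v\<in>e. c (Inl v) \<noteq> c (Inr e))"

definition incident_pairs :: "'a set \<Rightarrow> 'a set set \<Rightarrow> ('a \<times> 'a set) set" where
  "incident_pairs V E = {(v, e). v \<in> V \<and> e \<in> E \<and> v \<in> e}"

definition harmonious_total_colouring ::
  "'a set \<Rightarrow> 'a set set \<Rightarrow> ('a + 'a set \<Rightarrow> 'c) \<Rightarrow> bool" where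
  "harmonious_total_colouring V E c \<longleftrightarrow>
     total_colouring V E c \<and>
     (\<forall>(v, e) \<in> incident_pairs V E. \<forall>(w, f) \<in> incident_pairs V E.
        (v, e) \<noteq> (w, f) \<longrightarrow> {c (Inl v), c (Inr e)} \<noteq> {c (Inl w), c (Inr f)})"

text \<open>Since the graphs are finite, natural numbers suffice as colours.  The number of colours of
  a colouring is the number of colours that actually occur.\<close>

definition harmonious_total_chromatic_number :: "'a set \<Rightarrow> 'a set set \<Rightarrow> nat" where
  "harmonious_total_chromatic_number V E =
     (LEAST k. \<exists>c :: 'a + 'a set \<Rightarrow> nat.
        harmonious_total_colouring V E c \<and> card (c ` (V <+> E)) = k)"

lemma simple_graph_complete: "simple_graph (complete_verts n) (complete_edges n)"
  by (simp add: simple_graph_def complete_verts_def complete_edges_def)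

text \<open>The minimum in the definition is attained for every finite simple graph.\<close>

lemma harmonious_total_colouring_exists:
  assumes "simple_graph V E"
  shows "\<exists>c :: 'a + 'a set \<Rightarrow> nat. harmonious_total_colouring (V :: 'a set) E c"
proof -
  have "finite V" "E \<subseteq> Pow V"
    using assms by (auto simp: simple_graph_def)
  then have "finite (V <+> E)"
    by (meson finite_Plus finite_Pow_iff finite_subset)
  then obtain c :: "'a + 'a set \<Rightarrow> nat" where c: "inj_on c (V <+> E)"
    using finite_imp_inj_to_nat_seg by blast
  have vv: "c (Inl u) = c (Inl v) \<longleftrightarrow> u = v" if "u \<in> V" "v \<in> V" for u v
    using inj_on_eq_iff[OF c, of "Inl u" "Inl v"] that by auto
  have ee: "c (Inr e) = c (Inr f) \<longleftrightarrow> e = f" if "e \<in> E" "f \<in> E" for e f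
    using inj_on_eq_iff[OF c, of "Inr e" "Inr f"] that by auto
  have ve: "c (Inl v) \<noteq> c (Inr e)" if "v \<in> V" "e \<in> E" for v e
    using inj_on_eq_iff[OF c, of "Inl v" "Inr e"] that by auto
  have no_loop: "{u} \<notin> E" for u
    using assms by (auto simp: simple_graph_def)
  have "total_colouring V E c"
    using vv ee ve no_loop \<open>E \<subseteq> Pow V\<close> unfolding total_colouring_def
    by (metis PowD insert_absorb2 subsetD)
  moreover have "v = w \<and> e = f"
    if "v \<in> V" "e \<in> E" "w \<in> V" "f \<in> E" "{c (Inl v), c (Inr e)} = {c (Inl w), c (Inr f)}"
    for v e w f
    using that vv ee ve by (metis doubleton_eq_iff)
  ultimately have "harmonious_total_colouring V E c"
    unfolding harmonious_total_colouring_def incident_pairs_def by blast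
  then show ?thesis
    by blast
qed

end

theory Submission
  imports Defs
begin

text \<open>The vertices of \<open>K\<^sub>n\<close> all have different colours, so only the edges are left to be
coloured, by the \<open>n\<close> colours of the vertices and by some number \<open>e\<close> of extra colours.
Say that \<open>x\<close> sees \<open>w\<close> if some edge at \<open>x\<close> has the colour of the vertex \<open>w\<close>. A proper
edge colouring in which no edge has the colour of one of its ends is harmonious if and
only if no two vertices see each other.

Lower bound. Two vertices per edge see the colour of an edge coloured by a vertex, and
there are at most \<open>n choose 2\<close> such sightings, so at most half of the edges are coloured
by vertices. The other half is covered by \<open>e\<close> matchings with at most \<open>n div 2\<close> edges
each, which gives \<open>e \<ge> n / 2\<close> for \<open>n \<ge> 2\<close> (\<open>card_colours_ge\<close>). For \<open>n = 4\<close> two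
extra colours do not suffice, since both edges of a perfect matching can never be
coloured by vertices (\<open>card_colours_ge_7\<close>); with three extra colours no edge need be
coloured by a vertex.

Upper bound. The bound leaves almost no freedom: the relation of seeing is close to a
tournament. The constructions start from a rotational tournament on an odd number of
points on a circle, in which the points ahead of \<open>i\<close> by less than half a turn are those
that \<open>i\<close> may see. For \<open>n = 4 * k + 1\<close> all \<open>n\<close> vertices lie on one circle; edges of odd
cyclic length are coloured by vertices and edges of even cyclic length by extra colours.
For the other residues, the vertices are two copies \<open>A\<close> and \<open>B\<close> of a circle with
\<open>M = 2 * k + 1\<close> points and at most two further points. The edges inside each half take
the round-robin colours \<open>i + j\<close> modulo \<open>M\<close>, and an edge from \<open>A i\<close> to \<open>B j\<close> with
\<open>i \<noteq> j\<close> is coloured by one of the two copies of the midpoint of \<open>i\<close> and \<open>j\<close>. This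
settles \<open>n = 2 * M\<close>. In it \<open>A i\<close> and \<open>B i\<close> never see each other; a point added to one
half makes use of these pairs (\<open>n = 2 * M + 1\<close>), and if a point is added to each half,
some edges between the halves have to be recoloured as well (\<open>n = 2 * M + 2\<close>).\<close>

section \<open>Colourings of the edges by vertices and extra colours\<close>

text \<open>The vertices of \<open>K\<^sub>n\<close> have distinct colours, so each vertex may be identified with
its colour. What remains is to colour the edges, by vertices (\<open>Inl\<close>) and by \<open>e\<close> extra
colours (\<open>Inr\<close>). An incident pair of \<open>x\<close> with an edge coloured by the vertex \<open>w\<close>
produces the colour pair \<open>{x, w}\<close>; the only incident pair that could repeat it is one of
\<open>w\<close> with an edge coloured by \<open>x\<close>. The last clause excludes exactly this.\<close>

definition arc_colouring :: "'v set \<Rightarrow> nat \<Rightarrow> ('v \<Rightarrow> 'v \<Rightarrow> 'v + nat) \<Rightarrow> bool" where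
  "arc_colouring V e g \<longleftrightarrow>
     (\<forall>x\<in>V. \<forall>y\<in>V. x \<noteq> y \<longrightarrow> g x y = g y x \<and> g x y \<in> (V - {x}) <+> {..<e}) \<and>
     (\<forall>x\<in>V. \<forall>y\<in>V. \<forall>z\<in>V. x \<noteq> y \<longrightarrow> x \<noteq> z \<longrightarrow> g x y = g x z \<longrightarrow> y = z) \<and>
     (\<forall>x\<in>V. \<forall>y\<in>V. \<forall>w\<in>V. \<forall>z\<in>V. x \<noteq> y \<longrightarrow> w \<noteq> z \<longrightarrow> g x y = Inl w \<longrightarrow> g w z \<noteq> Inl x)"

lemma harmonious_total_chromatic_number_le:
  fixes c :: "'a + 'a set \<Rightarrow> nat"
  assumes "harmonious_total_colouring V E c" "card (c ` (V <+> E)) \<le> k"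
  shows "harmonious_total_chromatic_number V E \<le> k"
proof -
  have "\<exists>c' :: 'a + 'a set \<Rightarrow> nat. harmonious_total_colouring V E c' \<and>
      card (c' ` (V <+> E)) = card (c ` (V <+> E))"
    by (rule exI[of _ c]) (simp add: assms(1))
  then have "harmonious_total_chromatic_number V E \<le> card (c ` (V <+> E))"
    unfolding harmonious_total_chromatic_number_def by (rule Least_le)
  then show ?thesis using assms(2) by simp
qed

lemma harmonious_total_chromatic_number_ge:
  assumes "simple_graph V E"
    and bound: "\<And>c :: 'a + 'a set \<Rightarrow> nat.
      harmonious_total_colouring V E c \<Longrightarrow> k \<le> card (c ` (V <+> E))"
  shows "k \<le> harmonious_total_chromatic_number V E"
proof -
  obtain c :: "'a + 'a set \<Rightarrow> nat" where "harmonious_total_colouring V E c"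
    using harmonious_total_colouring_exists[OF assms(1)] by (rule exE)
  then have "\<exists>c' :: 'a + 'a set \<Rightarrow> nat. harmonious_total_colouring V E c' \<and>
      card (c' ` (V <+> E)) = card (c ` (V <+> E))"
    by (intro exI[of _ c]) simp
  then have "\<exists>c' :: 'a + 'a set \<Rightarrow> nat. harmonious_total_colouring V E c' \<and>
      card (c' ` (V <+> E)) = harmonious_total_chromatic_number V E"
    unfolding harmonious_total_chromatic_number_def by (rule LeastI)
  then obtain c' :: "'a + 'a set \<Rightarrow> nat" where "harmonious_total_colouring V E c'"
      "card (c' ` (V <+> E)) = harmonious_total_chromatic_number V E"
    by (elim exE conjE)
  then show ?thesis using bound[of c'] by simp
qed

text \<open>Along a numbering \<open>\<phi>\<close> of \<open>V\<close>, the vertex \<open>i\<close> takes the colour \<open>i\<close> and the extra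
colour \<open>t\<close> becomes \<open>n + t\<close>.\<close>

lemma arc_colouring_bound:
  assumes g: "arc_colouring V e g" and V: "finite V" "card V = n"
  shows "harmonious_total_chromatic_number (complete_verts n) (complete_edges n) \<le> n + e"
proof -
  obtain \<phi> where \<phi>: "bij_betw \<phi> {..<n} V"
    using ex_bij_betw_nat_finite[OF V(1)] V(2) unfolding atLeast0LessThan by blast
  define \<psi> where "\<psi> = the_inv_into {..<n} \<phi>"
  have \<phi>V: "\<phi> i \<in> V" if "i < n" for i
    using bij_betwE[OF \<phi>] that by simp
  have \<phi>inj: "\<phi> i = \<phi> j \<longleftrightarrow> i = j" if "i < n" "j < n" for i j
    using inj_on_eq_iff[OF bij_betw_imp_inj_on[OF \<phi>]] that by simp
  have \<psi>\<phi>: "\<psi> (\<phi> i) = i" if "i < n" for i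
    using the_inv_into_f_f[OF bij_betw_imp_inj_on[OF \<phi>]] that by (simp add: \<psi>_def)
  have \<psi>V: "\<psi> w < n" "\<phi> (\<psi> w) = w" if "w \<in> V" for w
    using that \<phi> unfolding \<psi>_def bij_betw_def
    by (auto simp: f_the_inv_into_f dest: the_inv_into_into[of \<phi> "{..<n}" w "{..<n}"])
  define code where "code = case_sum \<psi> (\<lambda>t. n + t)"
  define c :: "nat + nat set \<Rightarrow> nat"
    where "c = case_sum id (\<lambda>f. code (g (\<phi> (Min f)) (\<phi> (Max f))))"
  have sym: "g x y = g y x" and rng: "g x y \<in> (V - {x}) <+> {..<e}" if "x \<in> V" "y \<in> V" "x \<noteq> y" for x y
    using g that unfolding arc_colouring_def by blast+
  have rng': "g x y \<in> V <+> {..<e}" "g x y \<noteq> Inl x" if "x \<in> V" "y \<in> V" "x \<noteq> y" for x y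
    using rng[OF that] by auto
  have proper: "y = z" if "x \<in> V" "y \<in> V" "z \<in> V" "x \<noteq> y" "x \<noteq> z" "g x y = g x z" for x y z
    using g that unfolding arc_colouring_def by blast
  have arcs: "g w z \<noteq> Inl x" if "x \<in> V" "y \<in> V" "w \<in> V" "z \<in> V" "x \<noteq> y" "w \<noteq> z" "g x y = Inl w" for x y w z
    using g that unfolding arc_colouring_def by blast
  have code_inj: "s = t" if "s \<in> V <+> {..<e}" "t \<in> V <+> {..<e}" "code s = code t" for s t
  proof (cases s; cases t)
    fix x y assume "s = Inl x" "t = Inl y"
    then show ?thesis using that \<psi>V(2)[of x] \<psi>V(2)[of y] by (auto simp: code_def)
  qed (use that \<psi>V(1) in \<open>force simp: code_def\<close>)+
  have code_less: "code s < n + e" if "s \<in> V <+> {..<e}" for s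
    using that \<psi>V(1) unfolding code_def by (auto simp: trans_less_add1)
  have code_Inl: "code s = i \<longleftrightarrow> s = Inl (\<phi> i)" if "s \<in> V <+> {..<e}" "i < n" for s i
    using that \<psi>V(2) \<psi>\<phi>[of i] by (cases s) (auto simp: code_def)
  have edge: "c (Inr {i, j}) = code (g (\<phi> i) (\<phi> j))" if "i < n" "j < n" "i \<noteq> j" for i j
  proof -
    have "g (\<phi> i) (\<phi> j) = g (\<phi> j) (\<phi> i)"
      using that by (intro sym) (simp_all add: \<phi>V \<phi>inj)
    then have "g (\<phi> (Min {i, j})) (\<phi> (Max {i, j})) = g (\<phi> i) (\<phi> j)"
      by (simp add: min_def max_def)
    then show ?thesis by (simp add: c_def)
  qed
  have ends: "\<exists>j<n. v < n \<and> v \<noteq> j \<and> f = {v, j}" if "f \<in> complete_edges n" "v \<in> f" for v f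
    using that by (auto simp: complete_edges_def complete_verts_def card_2_iff)
  have vert: "c (Inl i) = i" for i by (simp add: c_def)
  have same: "f = f'" if f: "f \<in> complete_edges n" "v \<in> f" and f': "f' \<in> complete_edges n" "v \<in> f'"
    and eq: "c (Inr f) = c (Inr f')" for f f' v
  proof -
    obtain j where j: "j < n" "v < n" "v \<noteq> j" "f = {v, j}" using ends[OF f] by blast
    obtain j' where j': "j' < n" "v \<noteq> j'" "f' = {v, j'}" using ends[OF f'] by blast
    have ne: "\<phi> v \<noteq> \<phi> j" "\<phi> v \<noteq> \<phi> j'"
      using j j' \<phi>inj by simp_all
    note V = \<phi>V[OF j(2)] \<phi>V[OF j(1)] \<phi>V[OF j'(1)]
    have "code (g (\<phi> v) (\<phi> j)) = code (g (\<phi> v) (\<phi> j'))"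
      using eq j j' edge by simp
    then have "g (\<phi> v) (\<phi> j) = g (\<phi> v) (\<phi> j')"
      by (rule code_inj[OF rng'(1)[OF V(1,2) ne(1)] rng'(1)[OF V(1,3) ne(2)]])
    then have "j = j'" using proper[OF V ne] \<phi>inj j j' by simp
    then show ?thesis using j j' by simp
  qed
  have arc: "g (\<phi> v) (\<phi> j) = Inl (\<phi> w)" if "v < n" "j < n" "w < n" "v \<noteq> j" "c (Inr {v, j}) = w" for v j w
    using that edge[of v j] code_Inl[OF rng'(1)[OF \<phi>V[of v] \<phi>V[of j]], of w] \<phi>inj
    by simp
  have own: "c (Inl v) \<noteq> c (Inr f)" if f: "f \<in> complete_edges n" "v \<in> f" for f v
  proof
    assume eq: "c (Inl v) = c (Inr f)"
    obtain j where "j < n" "v < n" "v \<noteq> j" "f = {v, j}" using ends[OF f] by blast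
    then show False
      using arc[of v j v] eq vert rng'(2)[OF \<phi>V[of v] \<phi>V[of j]] \<phi>inj by simp
  qed
  have "total_colouring (complete_verts n) (complete_edges n) c"
    unfolding total_colouring_def
  proof (intro conjI ballI impI)
    fix u v assume "u \<in> complete_verts n" "v \<in> complete_verts n" "{u, v} \<in> complete_edges n"
    then show "c (Inl u) \<noteq> c (Inl v)" by (auto simp: vert complete_edges_def)
  next
    fix f f' assume "f \<in> complete_edges n" "f' \<in> complete_edges n" "f \<noteq> f' \<and> f \<inter> f' \<noteq> {}"
    then show "c (Inr f) \<noteq> c (Inr f')" using same by blast
  next
    fix f v assume "f \<in> complete_edges n" "v \<in> f"
    then show "c (Inl v) \<noteq> c (Inr f)" by (rule own)
  qed
  moreover have "(v, f) = (w, f')"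
    if vf: "v \<in> f" "f \<in> complete_edges n" and wf: "w \<in> f'" "f' \<in> complete_edges n"
      and eq: "{c (Inl v), c (Inr f)} = {c (Inl w), c (Inr f')}" for v f w f'
  proof (cases "v = w")
    case True
    then have "c (Inr f) = c (Inr f')" using eq by (auto simp: doubleton_eq_iff)
    then show ?thesis using same True vf wf by blast
  next
    case False
    then have "c (Inr f) = w" "c (Inr f') = v" using eq by (auto simp: doubleton_eq_iff vert)
    moreover obtain j where "j < n" "v < n" "v \<noteq> j" "f = {v, j}" using ends vf by blast
    moreover obtain j' where "j' < n" "w < n" "w \<noteq> j'" "f' = {w, j'}" using ends wf by blast
    ultimately show ?thesis
      using arc[of v j w] arc[of w j' v] arcs[OF \<phi>V[of v] \<phi>V[of j] \<phi>V[of w] \<phi>V[of j']] \<phi>inj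
      by simp
  qed
  ultimately have "harmonious_total_colouring (complete_verts n) (complete_edges n) c"
    unfolding harmonious_total_colouring_def incident_pairs_def by auto
  moreover have "c ` (complete_verts n <+> complete_edges n) \<subseteq> {..<n + e}"
  proof -
    have "c (Inr f) < n + e" if f: "f \<in> complete_edges n" for f
    proof -
      have "f \<noteq> {}" using f by (auto simp: complete_edges_def)
      then obtain v where "v \<in> f" by blast
      then obtain j where j: "j < n" "v < n" "v \<noteq> j" "f = {v, j}" using ends[OF f] by blast
      then show ?thesis
        using edge[of v j] code_less[OF rng'(1)[OF \<phi>V[of v] \<phi>V[of j]]] \<phi>inj by simp
    qed
    then show ?thesis by (auto simp: vert complete_verts_def)
  qed
  then have "card (c ` (complete_verts n <+> complete_edges n)) \<le> n + e"
    using card_mono[of "{..<n + e}"] by fastforce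
  ultimately show ?thesis by (rule harmonious_total_chromatic_number_le)
qed

section \<open>The lower bound\<close>

lemma finite_complete_edges: "finite (complete_edges n)"
  unfolding complete_edges_def complete_verts_def by simp

lemma card_complete_edges: "card (complete_edges n) = n choose 2"
  unfolding complete_edges_def complete_verts_def using n_subsets[of "{..<n}" 2] by simp

locale complete_harmonious =
  fixes n :: nat and c :: "nat + nat set \<Rightarrow> nat"
  assumes colouring: "harmonious_total_colouring (complete_verts n) (complete_edges n) c"
begin

abbreviation "E \<equiv> complete_edges n"

definition vertex_colours :: "nat set" where "vertex_colours = (\<lambda>v. c (Inl v)) ` {..<n}"
definition colours :: "nat set" where "colours = c ` (complete_verts n <+> E)"

lemma edgeD: "e \<in> E \<Longrightarrow> e \<subseteq> {..<n}" "e \<in> E \<Longrightarrow> card e = 2"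
  by (auto simp: complete_edges_def complete_verts_def)

lemma vertex_inj: "inj_on (\<lambda>v. c (Inl v)) {..<n}"
proof (rule inj_onI, rule ccontr)
  fix u v assume uv: "u \<in> {..<n}" "v \<in> {..<n}" "u \<noteq> v" and eq: "c (Inl u) = c (Inl v)"
  then have "{u, v} \<in> E" by (simp add: complete_edges_def complete_verts_def)
  then show False
    using uv eq colouring unfolding harmonious_total_colouring_def total_colouring_def complete_verts_def
    by blast
qed

lemma edge_vertex: "e \<in> E \<Longrightarrow> v \<in> e \<Longrightarrow> c (Inl v) \<noteq> c (Inr e)"
  using colouring unfolding harmonious_total_colouring_def total_colouring_def by blast

lemma edge_edge: "e \<in> E \<Longrightarrow> f \<in> E \<Longrightarrow> c (Inr e) = c (Inr f) \<Longrightarrow> e \<noteq> f \<Longrightarrow> e \<inter> f = {}"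
  using colouring unfolding harmonious_total_colouring_def total_colouring_def by blast

lemma pair_inj:
  assumes "e \<in> E" "f \<in> E" "v \<in> e" "w \<in> f" "{c (Inl v), c (Inr e)} = {c (Inl w), c (Inr f)}"
  shows "v = w \<and> e = f"
proof -
  have "(v, e) \<in> incident_pairs (complete_verts n) E" "(w, f) \<in> incident_pairs (complete_verts n) E"
    using assms edgeD(1) by (auto simp: incident_pairs_def complete_verts_def)
  then have "(v, e) = (w, f)"
    using colouring assms(5) unfolding harmonious_total_colouring_def by blast
  then show ?thesis by simp
qed

lemma finite_colours: "finite colours"
  unfolding colours_def using finite_complete_edges by (simp add: complete_verts_def)

lemma vertex_colours_subset: "vertex_colours \<subseteq> colours"
  by (auto simp: vertex_colours_def colours_def complete_verts_def)

lemma card_vertex_colours: "card vertex_colours = n"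
  unfolding vertex_colours_def using vertex_inj by (simp add: card_image)

lemma colour_class_le: "card {e \<in> E. c (Inr e) = t} \<le> n div 2"
proof -
  let ?F = "{e \<in> E. c (Inr e) = t}"
  have "(\<Sum>e\<in>?F. card e) = card (\<Union>?F)"
    using finite_complete_edges edge_edge edgeD(2)
    by (intro card_Union_disjoint[symmetric]) (auto simp: pairwise_def disjnt_def intro: card_ge_0_finite)
  also have "\<dots> \<le> card {..<n}"
    using edgeD(1) by (intro card_mono) auto
  finally show ?thesis using edgeD(2) by simp
qed

text \<open>Each edge coloured by a vertex contributes two colour pairs inside \<open>vertex_colours\<close>, all
different by harmoniousness, and \<open>vertex_colours\<close> has only \<open>n choose 2\<close> pairs.\<close>

lemma vertex_coloured_le: "2 * card {e \<in> E. c (Inr e) \<in> vertex_colours} \<le> n choose 2"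
proof -
  let ?F = "{e \<in> E. c (Inr e) \<in> vertex_colours}"
  let ?pair = "\<lambda>(e, v). {c (Inl v), c (Inr e)}"
  have fin: "finite e" if "e \<in> E" for e
    using edgeD(2)[OF that] by (intro card_ge_0_finite) simp
  have "card (Sigma ?F (\<lambda>e. e)) = (\<Sum>e\<in>?F. card e)"
    using finite_complete_edges fin by (intro card_SigmaI) auto
  then have "2 * card ?F = card (Sigma ?F (\<lambda>e. e))"
    using edgeD(2) by simp
  also have "\<dots> = card (?pair ` Sigma ?F (\<lambda>e. e))"
    by (rule card_image[symmetric]) (use pair_inj in \<open>force simp: inj_on_def\<close>)
  also have "\<dots> \<le> card {P. P \<subseteq> vertex_colours \<and> card P = 2}"
  proof (rule card_mono)
    show "finite {P. P \<subseteq> vertex_colours \<and> card P = 2}" by (simp add: vertex_colours_def)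
    show "?pair ` Sigma ?F (\<lambda>e. e) \<subseteq> {P. P \<subseteq> vertex_colours \<and> card P = 2}"
      using edgeD(1) edge_vertex by (fastforce simp: vertex_colours_def)
  qed
  also have "\<dots> = n choose 2"
    using n_subsets[of vertex_colours 2] card_vertex_colours by (simp add: vertex_colours_def)
  finally show ?thesis .
qed

text \<open>At most half of the edges are coloured from \<open>vertex_colours\<close>, so the other half has to
be covered by \<open>card colours - n\<close> matchings.\<close>

lemma counting: "n choose 2 \<le> 2 * (card colours - n) * (n div 2)"
proof -
  let ?F = "{e \<in> E. c (Inr e) \<in> vertex_colours}" and ?G = "{e \<in> E. c (Inr e) \<in> colours - vertex_colours}"
  have "E = ?F \<union> ?G" by (auto simp: colours_def)
  then have "n choose 2 \<le> card ?F + card ?G"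
    using card_Un_le[of ?F ?G] card_complete_edges by simp
  moreover have "card ?G \<le> (card colours - n) * (n div 2)"
  proof -
    have "?G = (\<Union>t\<in>colours - vertex_colours. {e \<in> E. c (Inr e) = t})" by auto
    then have "card ?G \<le> (\<Sum>t\<in>colours - vertex_colours. card {e \<in> E. c (Inr e) = t})"
      using card_UN_le[of "colours - vertex_colours"] finite_colours by simp
    also have "\<dots> \<le> (\<Sum>t\<in>colours - vertex_colours. n div 2)" by (intro sum_mono colour_class_le)
    also have "\<dots> = (card colours - n) * (n div 2)"
      using card_Diff_subset[OF finite_subset[OF vertex_colours_subset finite_colours] vertex_colours_subset] card_vertex_colours
      by simp
    finally show ?thesis .
  qed
  ultimately show ?thesis using vertex_coloured_le by linarith
qed

lemma card_colours_ge:
  assumes "n \<ge> 2"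
  shows "n + (n + 1) div 2 \<le> card colours"
proof -
  have "n \<le> card colours"
    using card_mono[OF finite_colours vertex_colours_subset] card_vertex_colours by simp
  define d where "d = card colours - n"
  have "n * (n - 1) div 2 \<le> 2 * d * (n div 2)"
    using counting by (simp add: choose_two d_def)
  have "(n + 1) div 2 \<le> d"
  proof (cases "even n")
    case True
    then obtain m where m: "n = 2 * m" by blast
    then have "m * (2 * m - 1) \<le> m * (2 * d)"
      using \<open>n * (n - 1) div 2 \<le> 2 * d * (n div 2)\<close> by (simp add: ac_simps)
    then have "2 * m - 1 \<le> 2 * d"
      using m assms nat_mult_le_cancel_disj[of m "2 * m - 1" "2 * d"] by simp
    then show ?thesis using m by simp
  next
    case False
    then obtain m where m: "n = 2 * m + 1" by (auto elim: oddE)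
    then have "m * (2 * m + 1) \<le> m * (2 * d)"
      using \<open>n * (n - 1) div 2 \<le> 2 * d * (n div 2)\<close> by (simp add: algebra_simps)
    then have "2 * m + 1 \<le> 2 * d"
      using m assms nat_mult_le_cancel_disj[of m "2 * m + 1" "2 * d"] by simp
    then show ?thesis using m by simp
  qed
  then show ?thesis using \<open>n \<le> card colours\<close> by (simp add: d_def)
qed

text \<open>A vertex whose colour is used on \<open>e\<close> is not an end of \<open>e\<close>, hence an end of \<open>f\<close>, and
conversely; then the end of \<open>f\<close> used on \<open>e\<close> and the end of \<open>e\<close> used on \<open>f\<close> form the same
colour pair twice.\<close>

lemma opposite_edges:
  assumes e: "e \<in> E" "f \<in> E" "e \<union> f = {..<n}"
  shows "c (Inr e) \<notin> vertex_colours \<or> c (Inr f) \<notin> vertex_colours"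
proof (rule ccontr)
  assume "\<not> ?thesis"
  then obtain v w where v: "v < n" "c (Inr e) = c (Inl v)" and w: "w < n" "c (Inr f) = c (Inl w)"
    by (auto simp: vertex_colours_def)
  have "v \<notin> e" "w \<notin> f" using edge_vertex e v w by metis+
  then have "v \<in> f" "w \<in> e" using e(3) v w by auto
  then have "w = v" using pair_inj[of e f w v] e v w by (simp add: insert_commute)
  then show False using \<open>v \<notin> e\<close> \<open>w \<in> e\<close> by simp
qed

text \<open>Each of the three perfect matchings of \<open>K\<^sub>4\<close> has an edge whose colour lies outside
\<open>vertex_colours\<close>. Edges from different perfect matchings meet, so these three colours
are distinct.\<close>

lemma card_colours_ge_7:
  assumes "n = 4"
  shows "7 \<le> card colours"
proof -
  have edge: "{i, j} \<in> E" if "i < 4" "j < 4" "i \<noteq> j" for i j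
    using that by (simp add: assms complete_edges_def complete_verts_def)
  have V: "{..<n} = {0, 1, 2, 3}" using assms by auto
  have "c (Inr {0, 1}) \<notin> vertex_colours \<or> c (Inr {2, 3}) \<notin> vertex_colours"
    by (intro opposite_edges edge) (auto simp: V)
  then obtain e1 where e1: "e1 = {0, 1} \<or> e1 = {2, 3}" "c (Inr e1) \<notin> vertex_colours" by blast
  have "c (Inr {0, 2}) \<notin> vertex_colours \<or> c (Inr {1, 3}) \<notin> vertex_colours"
    by (intro opposite_edges edge) (auto simp: V)
  then obtain e2 where e2: "e2 = {0, 2} \<or> e2 = {1, 3}" "c (Inr e2) \<notin> vertex_colours" by blast
  have "c (Inr {0, 3}) \<notin> vertex_colours \<or> c (Inr {1, 2}) \<notin> vertex_colours"
    by (intro opposite_edges edge) (auto simp: V)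
  then obtain e3 where e3: "e3 = {0, 3} \<or> e3 = {1, 2}" "c (Inr e3) \<notin> vertex_colours" by blast
  have E: "e1 \<in> E" "e2 \<in> E" "e3 \<in> E"
    using e1(1) e2(1) e3(1) by (elim disjE; simp add: edge)+
  have ne: "e1 \<noteq> e2" "e1 \<noteq> e3" "e2 \<noteq> e3" "e1 \<inter> e2 \<noteq> {}" "e1 \<inter> e3 \<noteq> {}" "e2 \<inter> e3 \<noteq> {}"
    using e1(1) e2(1) e3(1) by (elim disjE; simp add: doubleton_eq_iff)+
  let ?D = "{c (Inr e1), c (Inr e2), c (Inr e3)}"
  have "card ?D = 3" using edge_edge E ne by (auto simp: card_insert_if)
  moreover have "?D \<inter> vertex_colours = {}" using e1 e2 e3 by blast
  moreover have "finite vertex_colours" by (simp add: vertex_colours_def)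
  ultimately have "card (vertex_colours \<union> ?D) = 7"
    using card_Un_disjoint[of vertex_colours ?D] card_vertex_colours assms
    by (simp add: Int_commute)
  moreover have "vertex_colours \<union> ?D \<subseteq> colours"
    using vertex_colours_subset E by (auto simp: colours_def)
  ultimately show ?thesis
    using card_mono[OF finite_colours, of "vertex_colours \<union> ?D"] by simp
qed

end

section \<open>The cyclic colouring for \<open>n\<close> congruent to 1 modulo 4\<close>

text \<open>Numbers below the odd number \<open>M\<close> are placed on a circle; \<open>ahead M i h\<close> means that the
way forward from \<open>i\<close> to \<open>h\<close> is shorter than half a turn. This rotational tournament is
what keeps vertices from seeing each other in all colourings below.\<close>

definition ahead :: "nat \<Rightarrow> nat \<Rightarrow> nat \<Rightarrow> bool" where
  "ahead M i h \<longleftrightarrow> i < h \<and> 2 * h < 2 * i + M \<or> h < i \<and> 2 * h + M < 2 * i"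

lemma ahead_asym: "ahead n x y \<Longrightarrow> \<not> ahead n y x"
  by (auto simp: ahead_def)

lemma mod_below_double:
  assumes "u < 2 * (M::nat)"
  shows "u mod M = (if u < M then u else u - M)"
  using assms by (simp add: le_mod_geq)

text \<open>Let \<open>n = 4 * k + 1\<close>. The cyclic length of an edge is the shorter way round the circle,
at most \<open>2 * k\<close>. An edge of odd cyclic length is coloured by the vertex
\<open>(x + y + 2 * k + 1) / 2\<close> (modulo \<open>n\<close>), the point opposite its midpoint; it lies at most
\<open>2 * k\<close> ahead of both ends.

An edge of even cyclic length has the extra colour \<open>s div 2\<close> with \<open>s = (x + y) mod n\<close>,
so the two sum classes \<open>2 * t\<close> and \<open>2 * t + 1\<close> share a colour. Within the edges of even
length a sum class covers an interval of \<open>2 * k + 1\<close> vertices except its centre. The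
centres of consecutive sum classes are half a turn apart, so the two intervals meet in a
single vertex, where two edges of the maximal length \<open>2 * k\<close> collide. Removing one of
them leaves the two centres unmatched, and these are themselves joined by an edge of
length \<open>2 * k\<close>, which can be put in instead. Done for all \<open>t\<close> simultaneously, this
permutes the edges of length \<open>2 * k\<close> among the colours; the result is that edges
\<open>{x, x + 2 * k + 1}\<close> take the colour \<open>x\<close>.\<close>

definition cyclic_colour :: "nat \<Rightarrow> nat \<Rightarrow> nat \<Rightarrow> nat + nat" where
  "cyclic_colour k x y = (let n = 4 * k + 1; d = max x y - min x y in
     if odd d \<and> d < 2 * k then Inl (((x + y + 2 * k + 1) div 2) mod n)
     else if even d \<and> d > 2 * k then Inl ((x + y - 2 * k) div 2)
     else if d = 2 * k + 1 then Inr (min x y)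
     else Inr (((x + y) mod n) div 2))"

lemma cyclic_colour_commute: "cyclic_colour k x y = cyclic_colour k y x"
  unfolding cyclic_colour_def add.commute[of x y] max.commute[of x y] min.commute[of x y] ..

text \<open>Without the reduction modulo \<open>n\<close>, all conditions become linear.\<close>

lemma cyclic_less:
  assumes "x < y" "y \<le> 4 * k"
  shows "cyclic_colour k x y =
    (if odd (y - x) \<and> y - x < 2 * k then
       Inl (if x + y \<le> 6 * k then (x + y + 2 * k + 1) div 2 else (x + y - 6 * k - 1) div 2)
     else if even (y - x) \<and> y - x > 2 * k then Inl ((x + y - 2 * k) div 2)
     else if y - x = 2 * k + 1 then Inr x
     else Inr (if x + y \<le> 4 * k then (x + y) div 2 else (x + y - 4 * k - 1) div 2))"
proof -
  have "(x + y) mod (4 * k + 1) = (if x + y \<le> 4 * k then x + y else x + y - 4 * k - 1)"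
    using assms by (subst mod_below_double) auto
  moreover have "((x + y + 2 * k + 1) div 2) mod (4 * k + 1)
      = (if x + y \<le> 6 * k then (x + y + 2 * k + 1) div 2 else (x + y - 6 * k - 1) div 2)"
    if "odd (y - x)"
  proof -
    have "odd (x + y)" using that assms by simp
    then obtain m where "x + y = 2 * m + 1" by (rule oddE)
    moreover have "2 * m + 1 - 6 * k - 1 = 2 * (m - 3 * k)" by simp
    ultimately show ?thesis using assms by (subst mod_below_double) auto
  qed
  ultimately show ?thesis using assms by (simp add: cyclic_colour_def Let_def)
qed

lemma cyclic_Inl_less:
  assumes "x < y" "y \<le> 4 * k" "cyclic_colour k x y = Inl v"
  shows "v \<le> 4 * k"
    "2 * v = x + y + 2 * k + 1 \<or> 2 * v + 6 * k + 1 = x + y \<or> 2 * v + 2 * k = x + y"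
    "ahead (4 * k + 1) x v" "ahead (4 * k + 1) y v"
proof -
  consider (up) "odd (x + y)" "y - x < 2 * k" "x + y \<le> 6 * k" "v = (x + y + 2 * k + 1) div 2"
    | (down) "odd (x + y)" "y - x < 2 * k" "x + y > 6 * k" "v = (x + y - 6 * k - 1) div 2"
    | (wide) "even (x + y)" "y - x > 2 * k" "v = (x + y - 2 * k) div 2"
    using assms cyclic_less[of x y k] by (auto split: if_splits)
  then have "v \<le> 4 * k \<and>
    (2 * v = x + y + 2 * k + 1 \<or> 2 * v + 6 * k + 1 = x + y \<or> 2 * v + 2 * k = x + y) \<and>
    ahead (4 * k + 1) x v \<and> ahead (4 * k + 1) y v"
  proof cases
    case up
    then have "2 * v = x + y + 2 * k + 1" by simp
    then show ?thesis using up assms(1,2) unfolding ahead_def by linarith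
  next
    case down
    then have "2 * v = x + y - 6 * k - 1" by simp
    then have "2 * v + 6 * k + 1 = x + y" using down by linarith
    then show ?thesis using down assms(1,2) unfolding ahead_def by linarith
  next
    case wide
    then have "2 * v = x + y - 2 * k" by simp
    then have "2 * v + 2 * k = x + y" using wide by linarith
    moreover have "y \<noteq> x + 2 * k + 1" using wide(1) by auto
    ultimately show ?thesis using wide assms(1,2) unfolding ahead_def by linarith
  qed
  then show "v \<le> 4 * k"
    "2 * v = x + y + 2 * k + 1 \<or> 2 * v + 6 * k + 1 = x + y \<or> 2 * v + 2 * k = x + y"
    "ahead (4 * k + 1) x v" "ahead (4 * k + 1) y v" by simp_all
qed

lemma cyclic_Inl:
  assumes "x \<le> 4 * k" "y \<le> 4 * k" "x \<noteq> y" "cyclic_colour k x y = Inl v"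
  shows "v \<le> 4 * k"
    "2 * v = x + y + 2 * k + 1 \<or> 2 * v + 6 * k + 1 = x + y \<or> 2 * v + 2 * k = x + y"
    "ahead (4 * k + 1) x v"
  using assms cyclic_Inl_less[of x y k v] cyclic_Inl_less[of y x k v]
  by (cases "x < y"; simp add: cyclic_colour_commute[of k x y] add.commute[of x y])+

lemma cyclic_Inl_inject:
  assumes "x \<le> 4 * k" "y \<le> 4 * k" "z \<le> 4 * k" "x \<noteq> y" "x \<noteq> z"
    "cyclic_colour k x y = Inl v" "cyclic_colour k x z = Inl v"
  shows "y = z"
  using cyclic_Inl(2)[OF assms(1,2,4,6)] cyclic_Inl(2)[OF assms(1,3,5,7)] assms(1-3) by linarith

text \<open>The edges with an extra colour other than those that join \<open>x\<close> to \<open>x + 2 * k + 1\<close>.\<close>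

definition far :: "nat \<Rightarrow> nat \<Rightarrow> nat \<Rightarrow> bool" where
  "far k x y \<longleftrightarrow> even (x + y) \<and> x \<le> y + 2 * k \<and> y \<le> x + 2 * k
    \<or> odd (x + y) \<and> (x + 2 * k + 1 < y \<or> y + 2 * k + 1 < x)"

lemma far_commute: "far k x y = far k y x"
  by (auto simp: far_def add.commute)

lemma cyclic_Inr_less:
  assumes "x < y" "y \<le> 4 * k" "cyclic_colour k x y = Inr t"
  shows "y = x + 2 * k + 1 \<and> t = x \<or>
    far k x y \<and> 2 * t \<le> 4 * k \<and>
      (x + y = 2 * t \<or> x + y = 2 * t + 4 * k + 1 \<or>
       2 * t + 1 \<le> 4 * k \<and> (x + y = 2 * t + 1 \<or> x + y = 2 * t + 1 + 4 * k + 1))"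
proof (cases "y - x = 2 * k + 1")
  case True
  then have "y = x + 2 * k + 1" using assms(1) by linarith
  moreover have "t = x" using True assms(3) cyclic_less[OF assms(1,2)] by simp
  ultimately show ?thesis by blast
next
  case False
  have par: "even (y - x) = even (x + y)" using assms(1) by auto
  have "\<not> (odd (y - x) \<and> y - x < 2 * k)" "\<not> (even (y - x) \<and> y - x > 2 * k)"
    and t: "t = (if x + y \<le> 4 * k then (x + y) div 2 else (x + y - 4 * k - 1) div 2)"
    using False assms(3) cyclic_less[OF assms(1,2)] by (auto split: if_splits)
  moreover have "y - x \<noteq> 2 * k" if "odd (x + y)"
    using that unfolding par[symmetric] by (metis dvd_triv_left)
  ultimately have "even (x + y) \<Longrightarrow> y - x \<le> 2 * k" "odd (x + y) \<Longrightarrow> y - x > 2 * k + 1"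
    using False unfolding par by linarith+
  then have "far k x y"
    using assms(1) less_diff_conv[of "2 * k + 1" y x] le_diff_conv[of y x "2 * k"]
    unfolding far_def by (cases "even (x + y)") (simp_all add: ac_simps)
  moreover have "2 * (u div 2) = u \<or> 2 * (u div 2) + 1 = u" for u :: nat by presburger
  from this[of "x + y"] this[of "x + y - 4 * k - 1"]
  have "2 * t \<le> 4 * k \<and> (x + y = 2 * t \<or> x + y = 2 * t + 4 * k + 1 \<or>
       2 * t + 1 \<le> 4 * k \<and> (x + y = 2 * t + 1 \<or> x + y = 2 * t + 1 + 4 * k + 1))"
    using t assms(1,2) by (cases "x + y \<le> 4 * k") (simp_all, linarith+)
  ultimately show ?thesis by simp
qed

lemma cyclic_Inr:
  assumes "x \<le> 4 * k" "y \<le> 4 * k" "x \<noteq> y" "cyclic_colour k x y = Inr t"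
  shows "y = x + 2 * k + 1 \<and> t = x \<or> x = y + 2 * k + 1 \<and> t = y \<or>
    far k x y \<and> 2 * t \<le> 4 * k \<and>
      (x + y = 2 * t \<or> x + y = 2 * t + 4 * k + 1 \<or>
       2 * t + 1 \<le> 4 * k \<and> (x + y = 2 * t + 1 \<or> x + y = 2 * t + 1 + 4 * k + 1))"
proof (cases "x < y")
  case True
  then show ?thesis using cyclic_Inr_less[OF True assms(2,4)] by blast
next
  case False
  then have "y < x" using assms(3) by simp
  then show ?thesis
    using cyclic_Inr_less[of y x k t] assms
    by (simp add: cyclic_colour_commute[of k x] far_commute[of k x] add.commute[of y])
qed

text \<open>Edges at \<open>x\<close> whose sums are \<open>2 * t\<close> and \<open>2 * t + 1\<close> lead to cyclically consecutive
vertices. Their cyclic lengths are both even only across the point opposite to \<open>x\<close>,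
where one of the two edges is of the excluded kind or the smaller of the two sums is
odd.\<close>

lemma far_consecutive:
  assumes "x \<le> 4 * k" "y \<le> 4 * k" "z \<le> 4 * k" "far k x y" "far k x z"
    and y: "x + y = 2 * t \<or> x + y = 2 * t + 4 * k + 1"
    and z: "x + z = 2 * t + 1 \<or> x + z = 2 * t + 1 + 4 * k + 1"
  shows False
  using y
proof
  assume y: "x + y = 2 * t"
  then have "x \<le> y + 2 * k" "y \<le> x + 2 * k" using assms(4) by (auto simp: far_def)
  moreover from z have "x + z = 2 * t + 1" using y assms(3) by linarith
  moreover from this have "odd (x + z)" by simp
  then have "x + 2 * k + 1 < z \<or> z + 2 * k + 1 < x" using assms(5) by (auto simp: far_def)
  ultimately show False using y by linarith
next
  assume y: "x + y = 2 * t + 4 * k + 1"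
  then have "odd (x + y)" by simp
  then have far_y: "x + 2 * k + 1 < y \<or> y + 2 * k + 1 < x"
    using assms(4) by (auto simp: far_def)
  from z show False
  proof
    assume z: "x + z = 2 * t + 1"
    then have "odd (x + z)" by simp
    then have "x + 2 * k + 1 < z \<or> z + 2 * k + 1 < x" using assms(5) by (auto simp: far_def)
    then show False using y z far_y assms(1-3) by linarith
  next
    assume z: "x + z = 2 * t + 1 + 4 * k + 1"
    then have "even (x + z)" by simp
    then have "x \<le> z + 2 * k" "z \<le> x + 2 * k" using assms(5) by (auto simp: far_def)
    then show False using y z far_y by linarith
  qed
qed

lemma far_not_adjacent: "far k x y \<Longrightarrow> y \<noteq> Suc x \<and> x \<noteq> Suc y"
  by (auto simp: far_def)

lemma cyclic_Inr_inject:
  assumes "x \<le> 4 * k" "y \<le> 4 * k" "z \<le> 4 * k" "x \<noteq> y" "x \<noteq> z"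
    "cyclic_colour k x y = Inr t" "cyclic_colour k x z = Inr t"
  shows "y = z"
proof -
  note Y = cyclic_Inr[OF assms(1,2,4,6)] and Z = cyclic_Inr[OF assms(1,3,5,7)]
  have mixed: False
    if "u \<le> 4 * k" "v \<le> 4 * k" "x \<noteq> v" "u = x + 2 * k + 1 \<and> t = x \<or> x = u + 2 * k + 1 \<and> t = u" "far k x v"
      "x + v = 2 * t \<or> x + v = 2 * t + 4 * k + 1 \<or> x + v = 2 * t + 1 \<or> x + v = 2 * t + 1 + 4 * k + 1" for u v
    using that assms(1) far_not_adjacent[OF that(5)] by linarith
  let ?edge = "\<lambda>u. u = x + 2 * k + 1 \<and> t = x \<or> x = u + 2 * k + 1 \<and> t = u"
  let ?even = "\<lambda>u. x + u = 2 * t \<or> x + u = 2 * t + 4 * k + 1"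
  let ?odd = "\<lambda>u. x + u = 2 * t + 1 \<or> x + u = 2 * t + 1 + 4 * k + 1"
  have Y': "?edge y \<or> far k x y \<and> (?even y \<or> ?odd y)" using Y by blast
  have Z': "?edge z \<or> far k x z \<and> (?even z \<or> ?odd z)" using Z by blast
  consider "?edge y" "?edge z" | "far k x y" "far k x z" "?even y" "?even z"
    | "far k x y" "far k x z" "?odd y" "?odd z"
    using Y' Z' mixed[of y z] mixed[of z y] assms(2-5)
      far_consecutive[OF assms(1,2,3), of t] far_consecutive[OF assms(1,3,2), of t] by metis
  then show ?thesis using assms(1-3) by cases linarith+
qed

lemma upper_bound_1_mod_4:
  "harmonious_total_chromatic_number (complete_verts (4 * k + 1)) (complete_edges (4 * k + 1))
    \<le> 4 * k + 1 + (2 * k + 1)"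
proof (rule arc_colouring_bound)
  show "arc_colouring {..4 * k} (2 * k + 1) (cyclic_colour k)"
    unfolding arc_colouring_def
  proof (intro conjI ballI impI)
    fix x y assume xy: "x \<in> {..4 * k}" "y \<in> {..4 * k}" "x \<noteq> y"
    show "cyclic_colour k x y = cyclic_colour k y x" by (rule cyclic_colour_commute)
    show "cyclic_colour k x y \<in> ({..4 * k} - {x}) <+> {..<2 * k + 1}"
    proof (cases "cyclic_colour k x y")
      case (Inl v)
      then show ?thesis
        using cyclic_Inl[of x k y v] xy by (auto simp: ahead_def)
    next
      case (Inr t)
      then have "t \<le> 2 * k" using cyclic_Inr[of x k y t] xy by auto
      then show ?thesis using Inr by auto
    qed
  next
    fix x y z assume "x \<in> {..4 * k}" "y \<in> {..4 * k}" "z \<in> {..4 * k}" "x \<noteq> y" "x \<noteq> z"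
      and "cyclic_colour k x y = cyclic_colour k x z"
    then show "y = z"
      using cyclic_Inl_inject[of x k y z] cyclic_Inr_inject[of x k y z]
      by (cases "cyclic_colour k x z") simp_all
  next
    fix x y w z assume "x \<in> {..4 * k}" "y \<in> {..4 * k}" "w \<in> {..4 * k}" "z \<in> {..4 * k}"
      and "x \<noteq> y" "w \<noteq> z" "cyclic_colour k x y = Inl w"
    then show "cyclic_colour k w z \<noteq> Inl x"
      using cyclic_Inl(3)[of x k y w] cyclic_Inl(3)[of w k z x] ahead_asym by auto
  qed
qed simp_all

section \<open>Splitting the vertices into two halves\<close>

text \<open>The round-robin edge colouring of the complete graph on \<open>{0..M}\<close> with \<open>M\<close> colours, \<open>M\<close>
odd: the vertex \<open>M\<close> is the point at infinity, which receives from \<open>i\<close> the colour \<open>2 * i\<close>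
that \<open>i\<close> misses among the sums modulo \<open>M\<close>.\<close>

definition round_robin :: "nat \<Rightarrow> nat \<Rightarrow> nat \<Rightarrow> nat" where
  "round_robin M i j = (if j = M then 2 * i else if i = M then 2 * j else i + j) mod M"

lemma double_mod_inject:
  assumes "odd M" "i < M" "j < M" "2 * i mod M = 2 * j mod (M::nat)"
  shows "i = j"
proof -
  have "2 * i = 2 * j \<or> 2 * i = 2 * j + M \<or> 2 * j = 2 * i + M"
    using assms by (auto simp: mod_below_double split: if_splits)
  then show ?thesis using \<open>odd M\<close> by presburger
qed

lemma add_mod_inject:
  assumes "a < M" "i < M" "j < M" "(a + i) mod M = (a + j) mod (M::nat)"
  shows "i = j"
  using assms by (auto simp: mod_below_double split: if_splits)

lemma round_robin_commute: "round_robin M i j = round_robin M j i"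
  by (simp add: round_robin_def add.commute)

lemma round_robin_less: "odd M \<Longrightarrow> round_robin M i j < M"
  by (auto simp: round_robin_def intro!: mod_less_divisor odd_pos)

lemma round_robin_inject:
  assumes "odd M" "i \<le> M" "j \<le> M" "l \<le> M" "i \<noteq> j" "i \<noteq> l" "round_robin M i j = round_robin M i l"
  shows "j = l"
proof (cases "i = M")
  case True
  then show ?thesis using assms double_mod_inject[of M j l] by (simp add: round_robin_def)
next
  case False
  define j' l' where "j' = (if j = M then i else j)" and "l' = (if l = M then i else l)"
  have "(i + j') mod M = (i + l') mod M" "j' < M" "l' < M"
    using assms False by (auto simp: round_robin_def j'_def l'_def mult_2)
  then have "j' = l'" using assms False by (intro add_mod_inject[of i M j' l']) auto
  then show ?thesis using assms by (auto simp: j'_def l'_def split: if_splits)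
qed

text \<open>The index \<open>M\<close> is used for the point at infinity of the respective half.\<close>

datatype split_vertex = A nat | B nat

fun split_graph_colour :: "nat \<Rightarrow> (nat \<Rightarrow> nat \<Rightarrow> split_vertex + nat) \<Rightarrow> split_vertex \<Rightarrow> split_vertex \<Rightarrow> split_vertex + nat"
  where
    "split_graph_colour M T (A i) (A j) = Inr (round_robin M i j)"
  | "split_graph_colour M T (B i) (B j) = Inr (round_robin M i j)"
  | "split_graph_colour M T (A i) (B j) = T i j"
  | "split_graph_colour M T (B j) (A i) = T i j"

text \<open>Both halves reuse the same \<open>M\<close> round-robin colours, so only the edges between the halves
remain. Their colours form a table with rows \<open>A i\<close> and columns \<open>B j\<close>, and the hypotheses
say what being an arc colouring means for this table.\<close>

lemma table_bound:
  fixes T :: "nat \<Rightarrow> nat \<Rightarrow> split_vertex + nat"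
  assumes M: "odd M" "r \<le> Suc M" "s \<le> Suc M" "M \<le> e"
    and row: "\<And>i j j'. \<lbrakk>i < r; j < s; j' < s; T i j = T i j'\<rbrakk> \<Longrightarrow> j = j'"
    and col: "\<And>i i' j. \<lbrakk>i < r; i' < r; j < s; T i j = T i' j\<rbrakk> \<Longrightarrow> i = i'"
    and A: "\<And>i j h. \<lbrakk>i < r; j < s; T i j = Inl (A h)\<rbrakk> \<Longrightarrow> h < r \<and> h \<noteq> i"
    and B: "\<And>i j h. \<lbrakk>i < r; j < s; T i j = Inl (B h)\<rbrakk> \<Longrightarrow> h < s \<and> h \<noteq> j"
    and X: "\<And>i j t. \<lbrakk>i < r; j < s; T i j = Inr t\<rbrakk> \<Longrightarrow> t < e \<and>
      (\<forall>l<r. l \<noteq> i \<longrightarrow> round_robin M i l \<noteq> t) \<and> (\<forall>l<s. l \<noteq> j \<longrightarrow> round_robin M j l \<noteq> t)"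
    and AA: "\<And>i j h j'. \<lbrakk>i < r; j < s; h < r; j' < s; T i j = Inl (A h); T h j' = Inl (A i)\<rbrakk> \<Longrightarrow> False"
    and BB: "\<And>i j h i'. \<lbrakk>i < r; j < s; i' < r; h < s; T i j = Inl (B h); T i' h = Inl (B j)\<rbrakk> \<Longrightarrow> False"
    and AB: "\<And>i j h i'. \<lbrakk>i < r; j < s; i' < r; h < s; T i j = Inl (B h); T i' h = Inl (A i)\<rbrakk> \<Longrightarrow> False"
  shows "harmonious_total_chromatic_number (complete_verts (r + s)) (complete_edges (r + s))
    \<le> r + s + e"
proof (rule arc_colouring_bound)
  let ?V = "A ` {..<r} \<union> B ` {..<s}" and ?g = "split_graph_colour M T"
  show "finite ?V" by simp
  show "card ?V = r + s"
    by (subst card_Un_disjoint) (auto simp: card_image inj_on_def)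
  have Vcases: "(\<exists>i<r. x = A i) \<or> (\<exists>j<s. x = B j)" if "x \<in> ?V" for x
    using that by auto
  have rr: "round_robin M i j < e" for i j
    using round_robin_less[OF M(1), of i j] M(4) by simp
  have range: "?g x y \<in> (?V - {x}) <+> {..<e}" if xy: "x \<in> ?V" "y \<in> ?V" "x \<noteq> y" for x y
  proof -
    have T: "T i j \<in> (?V - {A i, B j}) <+> {..<e}" if "i < r" "j < s" for i j
    proof (cases "T i j")
      case (Inl v)
      then show ?thesis using that A[of i j] B[of i j] by (cases v) auto
    next
      case (Inr t)
      then show ?thesis using that X[of i j t] by auto
    qed
    show ?thesis
      using Vcases[OF xy(1)] Vcases[OF xy(2)] rr T by fastforce
  qed
  have comm: "?g x y = ?g y x" for x y
    by (cases x; cases y) (simp_all add: round_robin_commute)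
  have proper: "y = z" if xyz: "x \<in> ?V" "y \<in> ?V" "z \<in> ?V" "x \<noteq> y" "x \<noteq> z" "?g x y = ?g x z" for x y z
  proof (cases x)
    case x: (A i)
    show ?thesis
    proof (cases y; cases z)
      fix j l assume "y = A j" "z = A l"
      then show ?thesis using xyz x M round_robin_inject[of M i j l] by auto
    next
      fix j l assume "y = A j" "z = B l"
      then show ?thesis using xyz x X[of i l "round_robin M i j"] by auto
    next
      fix j l assume "y = B j" "z = A l"
      then show ?thesis using xyz x X[of i j "round_robin M i l"] by auto
    next
      fix j l assume "y = B j" "z = B l"
      then show ?thesis using xyz x row[of i j l] by auto
    qed
  next
    case x: (B i)
    show ?thesis
    proof (cases y; cases z)
      fix j l assume "y = B j" "z = B l"
      then show ?thesis using xyz x M round_robin_inject[of M i j l] by auto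
    next
      fix j l assume "y = B j" "z = A l"
      then show ?thesis using xyz x X[of l i "round_robin M i j"] by auto
    next
      fix j l assume "y = A j" "z = B l"
      then show ?thesis using xyz x X[of j i "round_robin M i l"] by auto
    next
      fix j l assume "y = A j" "z = A l"
      then show ?thesis using xyz x col[of j l i] by auto
    qed
  qed
  have antisym: False
    if xyz: "x \<in> ?V" "y \<in> ?V" "w \<in> ?V" "z \<in> ?V" and xy: "?g x y = Inl w" and wz: "?g w z = Inl x" for x y w z
  proof (cases x; cases w)
    fix i h assume "x = A i" "w = A h"
    then show False using xyz xy wz AA[of i _ h] by (cases y; cases z) auto
  next
    fix j h assume "x = B j" "w = B h"
    then show False using xyz xy wz BB[of _ j _ h] by (cases y; cases z) auto
  next
    fix i h assume "x = A i" "w = B h"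
    then show False using xyz xy wz AB[of i _ _ h] by (cases y; cases z) auto
  next
    fix i h assume "x = B h" "w = A i"
    then show False using xyz xy wz AB[of i _ _ h] by (cases y; cases z) auto
  qed
  show "arc_colouring ?V e ?g"
    unfolding arc_colouring_def using comm range proper antisym by (intro conjI ballI impI notI)
qed

section \<open>The midpoint table\<close>

text \<open>Half of \<open>i + j\<close> modulo the odd number \<open>M\<close>: the midpoint of \<open>i\<close> and \<open>j\<close> on the circle.\<close>

definition half :: "nat \<Rightarrow> nat \<Rightarrow> nat \<Rightarrow> nat" where
  "half M i j = (if even (i + j) then (i + j) div 2
     else if i + j < M then (i + j + M) div 2 else (i + j - M) div 2)"

text \<open>Let \<open>h\<close> be the midpoint of \<open>i\<close> and \<open>j\<close>. The edge from \<open>A i\<close> to \<open>B j\<close> is coloured by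
\<open>A h\<close> if \<open>h\<close> is ahead of \<open>i\<close>, and by \<open>B h\<close> if \<open>h\<close> is ahead of \<open>j\<close>; the parity test below
decides which of the two is the case. Hence \<open>A i\<close> sees \<open>A h\<close> only if \<open>h\<close> is ahead of
\<open>i\<close>, likewise for \<open>B\<close>, while \<open>A i\<close> sees \<open>B h\<close> only if \<open>i\<close> is ahead of \<open>h\<close> and \<open>B j\<close> sees
\<open>A h\<close> only if \<open>j\<close> is ahead of \<open>h\<close>. So no two vertices see each other, and \<open>A h\<close> and
\<open>B h\<close> do not see each other at all; the tables with points at infinity live off these
unused pairs.\<close>

definition midpoint :: "nat \<Rightarrow> nat \<Rightarrow> nat \<Rightarrow> split_vertex" where
  "midpoint M i j = (if i < j \<longleftrightarrow> even (i + j) then A (half M i j) else B (half M i j))"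

lemma half_iff:
  assumes "odd M" "i < M" "j < M"
  shows "half M i j = h \<longleftrightarrow> h < M \<and>
    (if even (i + j) then 2 * h = i + j else 2 * h = i + j + M \<or> 2 * h + M = i + j)"
proof (cases "even (i + j)")
  case True
  then have "2 * ((i + j) div 2) = i + j" by simp
  then show ?thesis using assms True unfolding half_def by auto
next
  case False
  then have "2 * ((i + j + M) div 2) = i + j + M" "M \<le> i + j \<Longrightarrow> 2 * ((i + j - M) div 2) = i + j - M"
    using assms(1) by simp_all
  then show ?thesis using assms False unfolding half_def by auto
qed

lemma midpoint_A:
  assumes "odd M" "i < M" "j < M"
  shows "midpoint M i j = A h \<longleftrightarrow> h < M \<and> (i < j \<and> 2 * h = i + j \<or>
    i \<ge> j \<and> (2 * h = i + j + M \<or> 2 * h + M = i + j))"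
proof -
  have "2 * h = i + j \<Longrightarrow> even (i + j)"
    "2 * h = i + j + M \<Longrightarrow> odd (i + j)" "2 * h + M = i + j \<Longrightarrow> odd (i + j)"
    using assms(1) by presburger+
  then show ?thesis
    using half_iff[OF assms, of h] unfolding midpoint_def
    by (cases "i < j"; cases "even (i + j)") auto
qed

lemma midpoint_B:
  assumes "odd M" "i < M" "j < M"
  shows "midpoint M i j = B h \<longleftrightarrow> h < M \<and> (i \<ge> j \<and> 2 * h = i + j \<or>
    i < j \<and> (2 * h = i + j + M \<or> 2 * h + M = i + j))"
proof -
  have "2 * h = i + j \<Longrightarrow> even (i + j)"
    "2 * h = i + j + M \<Longrightarrow> odd (i + j)" "2 * h + M = i + j \<Longrightarrow> odd (i + j)"
    using assms(1) by presburger+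
  then show ?thesis
    using half_iff[OF assms, of h] unfolding midpoint_def
    by (cases "i < j"; cases "even (i + j)") auto
qed

lemmas midpoint_flip =
  eq_commute[of "A h" "midpoint M i j" for h M i j] eq_commute[of "B h" "midpoint M i j" for h M i j]

lemma midpoint_row:
  assumes "odd M" "i < M" "j < M" "j' < M" "midpoint M i j = v" "midpoint M i j' = v"
  shows "j = j'"
  using assms by (cases v) (auto simp: midpoint_A midpoint_B)

lemma midpoint_col:
  assumes "odd M" "i < M" "i' < M" "j < M" "midpoint M i j = v" "midpoint M i' j = v"
  shows "i = i'"
  using assms by (cases v) (auto simp: midpoint_A midpoint_B)

text \<open>For \<open>n = 2 * M\<close> the diagonal edge at \<open>A i\<close> and \<open>B i\<close> takes the round-robin colour that
both ends miss.\<close>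

definition table_2_mod_4 where
  "table_2_mod_4 M i j = (if i = j then Inr (2 * i mod M) else Inl (midpoint M i j))"

lemma upper_bound_2_mod_4:
  assumes "odd M"
  shows "harmonious_total_chromatic_number (complete_verts (M + M)) (complete_edges (M + M))
    \<le> M + M + M"
proof (rule table_bound[where M = M and T = "table_2_mod_4 M"])
  fix i j h j' assume "i < M" "j < M" "h < M" "j' < M"
    "table_2_mod_4 M i j = Inl (A h)" "table_2_mod_4 M h j' = Inl (A i)"
  then show False using assms by (auto simp: table_2_mod_4_def midpoint_A split: if_splits)
next
  fix i j h i' assume "i < M" "j < M" "h < M" "i' < M"
    "table_2_mod_4 M i j = Inl (B h)" "table_2_mod_4 M i' h = Inl (B j)"
  then show False using assms by (auto simp: table_2_mod_4_def midpoint_B split: if_splits)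
next
  fix i j h i' assume "i < M" "j < M" "h < M" "i' < M"
    "table_2_mod_4 M i j = Inl (B h)" "table_2_mod_4 M i' h = Inl (A i)"
  then show False
    using assms by (auto simp: table_2_mod_4_def midpoint_A midpoint_B split: if_splits)
next
  fix i j h assume "i < M" "j < M" "table_2_mod_4 M i j = Inl (A h)"
  then show "h < M \<and> h \<noteq> i"
    using assms by (auto simp: table_2_mod_4_def midpoint_A split: if_splits)
next
  fix i j h assume "i < M" "j < M" "table_2_mod_4 M i j = Inl (B h)"
  then show "h < M \<and> h \<noteq> j"
    using assms by (auto simp: table_2_mod_4_def midpoint_B split: if_splits)
next
  fix i j t assume "i < M" "j < M" "table_2_mod_4 M i j = Inr t"
  then show "t < M \<and> (\<forall>l<M. l \<noteq> i \<longrightarrow> round_robin M i l \<noteq> t)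
      \<and> (\<forall>l<M. l \<noteq> j \<longrightarrow> round_robin M j l \<noteq> t)"
    using assms add_mod_inject[of i M _ i]
    by (auto simp: table_2_mod_4_def round_robin_def mult_2 split: if_splits)
next
  fix i j j' assume "i < M" "j < M" "j' < M" "table_2_mod_4 M i j = table_2_mod_4 M i j'"
  then show "j = j'"
    using assms midpoint_row[of M i j j'] by (auto simp: table_2_mod_4_def split: if_splits)
next
  fix i i' j assume "i < M" "i' < M" "j < M" "table_2_mod_4 M i j = table_2_mod_4 M i' j"
  then show "i = i'"
    using assms midpoint_col[of M i i' j] by (auto simp: table_2_mod_4_def split: if_splits)
qed (use assms in auto)

text \<open>For \<open>n = 2 * M + 1\<close> the point \<open>A M\<close> takes the round-robin colours that the \<open>A i\<close> miss,
the diagonal moves to one new extra colour, and the edge from \<open>A M\<close> to \<open>B j\<close> uses the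
pair of \<open>B j\<close> and \<open>A j\<close>, which the midpoint table leaves free.\<close>

definition table_3_mod_4 where
  "table_3_mod_4 M i j = (if i = M then Inl (A j) else if i = j then Inr M else Inl (midpoint M i j))"

lemma upper_bound_3_mod_4:
  assumes "odd M"
  shows "harmonious_total_chromatic_number (complete_verts (Suc M + M)) (complete_edges (Suc M + M))
    \<le> Suc M + M + Suc M"
proof (rule table_bound[where M = M and T = "table_3_mod_4 M"])
  fix i j h j' assume "i < Suc M" "j < M" "h < Suc M" "j' < M"
    "table_3_mod_4 M i j = Inl (A h)" "table_3_mod_4 M h j' = Inl (A i)"
  then show False
    using assms by (auto simp: table_3_mod_4_def midpoint_A less_Suc_eq split: if_splits)
next
  fix i j h i' assume "i < Suc M" "j < M" "i' < Suc M" "h < M"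
    "table_3_mod_4 M i j = Inl (B h)" "table_3_mod_4 M i' h = Inl (B j)"
  then show False
    using assms by (auto simp: table_3_mod_4_def midpoint_B less_Suc_eq split: if_splits)
next
  fix i j h i' assume "i < Suc M" "j < M" "i' < Suc M" "h < M"
    "table_3_mod_4 M i j = Inl (B h)" "table_3_mod_4 M i' h = Inl (A i)"
  then show False
    using assms by (auto simp: table_3_mod_4_def midpoint_A midpoint_B less_Suc_eq split: if_splits)
next
  fix i j h assume "i < Suc M" "j < M" "table_3_mod_4 M i j = Inl (A h)"
  then show "h < Suc M \<and> h \<noteq> i"
    using assms by (auto simp: table_3_mod_4_def midpoint_A less_Suc_eq split: if_splits)
next
  fix i j h assume "i < Suc M" "j < M" "table_3_mod_4 M i j = Inl (B h)"
  then show "h < M \<and> h \<noteq> j"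
    using assms by (auto simp: table_3_mod_4_def midpoint_B less_Suc_eq split: if_splits)
next
  fix i j t assume "i < Suc M" "j < M" "table_3_mod_4 M i j = Inr t"
  then have "t = M" by (auto simp: table_3_mod_4_def split: if_splits)
  then show "t < Suc M \<and> (\<forall>l<Suc M. l \<noteq> i \<longrightarrow> round_robin M i l \<noteq> t)
      \<and> (\<forall>l<M. l \<noteq> j \<longrightarrow> round_robin M j l \<noteq> t)"
    using round_robin_less[of M] assms by (auto simp: less_le)
next
  fix i j j' assume "i < Suc M" "j < M" "j' < M" "table_3_mod_4 M i j = table_3_mod_4 M i j'"
  then show "j = j'"
    using assms midpoint_row[of M i j j']
    by (auto simp: table_3_mod_4_def less_Suc_eq midpoint_A midpoint_B midpoint_flip split: if_splits)
next
  fix i i' j assume "i < Suc M" "i' < Suc M" "j < M" "table_3_mod_4 M i j = table_3_mod_4 M i' j"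
  then show "i = i'"
    using assms midpoint_col[of M i i' j]
    by (auto simp: table_3_mod_4_def less_Suc_eq midpoint_A midpoint_B midpoint_flip split: if_splits)
qed (use assms in auto)

section \<open>Two points at infinity\<close>

text \<open>For \<open>n = 2 * M + 2\<close> there are two points at infinity, \<open>A M\<close> and \<open>B M\<close>, but each free
pair of \<open>A j\<close> and \<open>B j\<close> serves only one of the edges \<open>{A M, B j}\<close> and \<open>{A j, B M}\<close>: the
first for even \<open>j\<close> (colour \<open>A j\<close>), the second for odd \<open>j\<close> (colour \<open>B j\<close>). The remaining
half of these edges steals from the midpoint table. For even \<open>j\<close>, the edge \<open>{A j, B M}\<close>
takes the colour \<open>A (j + 1)\<close>, and \<open>{A j, B (j + 2)}\<close>, which had that colour, is
recoloured by \<open>B M\<close>; for odd \<open>j\<close>, \<open>{A M, B j}\<close> takes \<open>B (j + 1)\<close> and \<open>{A (j + 2), B j}\<close>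
is recoloured by \<open>A M\<close>. This is consistent as \<open>A M\<close> and \<open>B M\<close> then see vertices of the
index parity opposite to that of the vertices that see them, apart from the wrap-around.
Since \<open>M\<close> is odd, the alternation does not close up around the circle; the entries at
\<open>{A M, B 0}\<close>, \<open>{A M, B 1}\<close>, \<open>{A 1, B M}\<close> and \<open>{A 0, B 2}\<close> repair this.\<close>

definition table_0_mod_4 where
  "table_0_mod_4 M i j =
    (if i = j then Inr M
     else if i = M then
       Inl (if j = 0 then B M else if j = 1 then A 1 else if even j then A j else B (j + 1))
     else if j = M then
       Inl (if i = 1 then B 2 else if odd i then B i else if i + 1 = M then A 0 else A (i + 1))
     else if i = 0 \<and> j = 2 then Inl (B 1)
     else if even i \<and> (j = i + 2 \<or> j + M = i + 2) then Inl (B M)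
     else if odd j \<and> (i = j + 2 \<or> i + M = j + 2) then Inl (A M)
     else Inl (midpoint M i j))"

lemma table_0_mod_4_A:
  assumes "odd M" "M \<ge> 3" "i \<le> M" "j \<le> M" "table_0_mod_4 M i j = Inl (A h)"
  shows "i = M \<and> j = h \<and> h < M \<and> (h = 1 \<or> even h \<and> h \<noteq> 0) \<or>
    j = M \<and> even i \<and> i < M \<and> (h = i + 1 \<and> h < M \<or> h = 0 \<and> i + 1 = M) \<or>
    h = M \<and> i < M \<and> odd j \<and> j < M \<and> (i = j + 2 \<or> i + M = j + 2) \<or>
    i < j \<and> j < M \<and> 2 * h = i + j \<and> (j = i + 2 \<longrightarrow> odd i) \<or>
    j < i \<and> i < M \<and> h < M \<and> (2 * h = i + j + M \<or> 2 * h + M = i + j) \<and> (j + M = i + 2 \<longrightarrow> odd i)"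
proof -
  consider "i < M" "j < M" | "i = M" "j < M" | "i < M" "j = M" | "i = M" "j = M"
    using assms by linarith
  then show ?thesis
  proof cases
    case 1
    then show ?thesis using assms(5) midpoint_A[OF assms(1) 1, of h] unfolding table_0_mod_4_def
      by (simp split: if_splits) auto
  next
    case 2
    then show ?thesis using assms(5) unfolding table_0_mod_4_def
      by (simp split: if_splits)
  next
    case 3
    then have "even i \<Longrightarrow> i + 1 \<noteq> M \<Longrightarrow> i + 1 < M" by simp
    with 3 show ?thesis using assms(5) unfolding table_0_mod_4_def
      by (simp split: if_splits)
  next
    case 4
    then show ?thesis using assms(5) unfolding table_0_mod_4_def by simp
  qed
qed

lemma table_0_mod_4_B:
  assumes "odd M" "M \<ge> 3" "i \<le> M" "j \<le> M" "table_0_mod_4 M i j = Inl (B h)"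
  shows "i = M \<and> (j = 0 \<and> h = M \<or> odd j \<and> j \<ge> 3 \<and> h = j + 1 \<and> h < M) \<or>
    j = M \<and> i < M \<and> (i = 1 \<and> h = 2 \<or> odd i \<and> i \<ge> 3 \<and> h = i) \<or>
    i = 0 \<and> j = 2 \<and> h = 1 \<or>
    h = M \<and> i < M \<and> j < M \<and> even i \<and> i \<ge> 2 \<and> (j = i + 2 \<or> j + M = i + 2) \<or>
    j < i \<and> i < M \<and> 2 * h = i + j \<and> (i = j + 2 \<longrightarrow> even j) \<or>
    i < j \<and> j < M \<and> h < M \<and> (2 * h = i + j + M \<or> 2 * h + M = i + j) \<and> (i + M = j + 2 \<longrightarrow> even j)"
proof -
  consider "i < M" "j < M" | "i = M" "j < M" | "i < M" "j = M" | "i = M" "j = M"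
    using assms by linarith
  then show ?thesis
  proof cases
    case 1
    then show ?thesis using assms(2,5) midpoint_B[OF assms(1) 1, of h] unfolding table_0_mod_4_def
      by (simp split: if_splits) auto
  next
    case 2
    have "odd j \<Longrightarrow> j + 1 < M" "odd j \<Longrightarrow> j \<noteq> 1 \<Longrightarrow> j \<ge> 3"
      using 2 \<open>odd M\<close> by presburger+
    then show ?thesis using 2 assms(5) unfolding table_0_mod_4_def
      by (simp split: if_splits)
  next
    case 3
    have "odd i \<Longrightarrow> i \<noteq> 1 \<Longrightarrow> i \<ge> 3" by presburger
    then show ?thesis using 3 assms(5) unfolding table_0_mod_4_def
      by (simp split: if_splits)
  next
    case 4
    then show ?thesis using assms(5) unfolding table_0_mod_4_def by simp
  qed
qed

lemma table_0_mod_4_Inr: "table_0_mod_4 M i j = Inr t \<Longrightarrow> i = j \<and> t = M"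
  by (auto simp: table_0_mod_4_def split: if_splits)

text \<open>The relations \<open>arc_AA\<close>, \<open>arc_BB\<close> and \<open>arc_AB\<close> contain the pairs in which a row vertex
\<open>A i\<close> sees \<open>A h\<close>, a column vertex \<open>B j\<close> sees \<open>B h\<close>, and \<open>A i\<close> sees \<open>B h\<close>. Among finite
indices they are \<open>ahead\<close>, or its converse for \<open>arc_AB\<close>, up to the arcs added on the
pairs \<open>A j\<close>, \<open>B j\<close> and the corrections at the indices \<open>0\<close>, \<open>1\<close> and \<open>2\<close>.\<close>

definition arc_AA where
  "arc_AA M i h \<longleftrightarrow>
    (if i = M then h = 1 \<or> even h \<and> h \<noteq> 0
     else if h = M then i = 0 \<or> odd i \<and> i \<noteq> 1
     else ahead M i h)"

definition arc_BB where
  "arc_BB M j h \<longleftrightarrow>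
    (if j = M then h = 2 \<or> odd h \<and> h \<noteq> 1 \<and> h \<noteq> M
     else if h = M then j = 0 \<or> j = 1 \<or> even j \<and> j \<noteq> 2
     else if h = 2 \<and> j = 1 then False
     else h = 1 \<and> j = 2 \<or> ahead M j h)"

definition arc_AB where
  "arc_AB M i h \<longleftrightarrow>
    (if i = M then h = M \<or> even h \<and> h \<ge> 4
     else if h = M then even i \<and> i \<noteq> 0
     else i = h \<and> odd i \<and> i \<noteq> 1 \<or> i = 0 \<and> h = 1 \<or> i = 1 \<and> h = 2 \<or> ahead M h i)"

lemma arc_AA_asym: "odd M \<Longrightarrow> M \<ge> 3 \<Longrightarrow> arc_AA M i h \<Longrightarrow> \<not> arc_AA M h i"
  by (auto simp: arc_AA_def ahead_def split: if_splits)

lemma arc_BB_asym: "odd M \<Longrightarrow> M \<ge> 3 \<Longrightarrow> arc_BB M j h \<Longrightarrow> \<not> arc_BB M h j"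
  by (auto simp: arc_BB_def ahead_def odd_pos split: if_splits)

lemma table_0_mod_4_arc_AA:
  assumes "odd M" "M \<ge> 3" "i \<le> M" "j \<le> M" "table_0_mod_4 M i j = Inl (A h)"
  shows "arc_AA M i h"
  using table_0_mod_4_A[OF assms] assms(1,2) unfolding arc_AA_def ahead_def
  by (elim disjE conjE) (auto; presburger)+

lemma table_0_mod_4_arc_BB:
  assumes "odd M" "M \<ge> 3" "i \<le> M" "j \<le> M" "table_0_mod_4 M i j = Inl (B h)"
  shows "arc_BB M j h"
  using table_0_mod_4_B[OF assms] assms(1,2) unfolding arc_BB_def ahead_def
  by (elim disjE conjE) (auto; presburger)+

lemma table_0_mod_4_arc_AB:
  assumes "odd M" "M \<ge> 3" "i \<le> M" "j \<le> M" "table_0_mod_4 M i j = Inl (B h)"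
  shows "arc_AB M i h"
  using table_0_mod_4_B[OF assms] assms(1,2) unfolding arc_AB_def ahead_def
  by (elim disjE conjE) (auto; presburger)+

lemma table_0_mod_4_not_arc_AB:
  assumes "odd M" "M \<ge> 3" "i \<le> M" "j \<le> M" "table_0_mod_4 M i j = Inl (A h)"
  shows "\<not> arc_AB M h j"
  using table_0_mod_4_A[OF assms] assms(1,2) unfolding arc_AB_def ahead_def
  by (elim disjE conjE) (auto; presburger)+

text \<open>A weaker description that suffices to recover \<open>j\<close> from \<open>i\<close> and \<open>h\<close>, and \<open>i\<close> from \<open>j\<close> and
\<open>h\<close>: if \<open>i\<close>, \<open>j\<close> and \<open>h\<close> are finite, then \<open>h\<close> is the midpoint of \<open>i\<close> and \<open>j\<close>, and the
parity conditions separate a colour used towards a point at infinity from its former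
place in the midpoint table.\<close>

lemma table_0_mod_4_A_cong:
  assumes "odd M" "M \<ge> 3" "i \<le> M" "j \<le> M" "table_0_mod_4 M i j = Inl (A h)"
  shows "i = M \<and> j = h \<and> h < M \<or>
    j = M \<and> i < M \<and> h < M \<and> even i \<and> (h = i + 1 \<or> h + M = i + 1) \<or>
    h = M \<and> i < M \<and> j < M \<and> (i = j + 2 \<or> i + M = j + 2) \<or>
    h < M \<and> i < M \<and> j < M \<and> i \<noteq> j \<and> (2 * h = i + j \<or> 2 * h = i + j + M \<or> 2 * h + M = i + j) \<and>
      (even i \<longrightarrow> h \<noteq> i + 1 \<and> h + M \<noteq> i + 1)"
  using table_0_mod_4_A[OF assms] assms(1,2) by (elim disjE conjE) auto

lemma table_0_mod_4_B_cong:
  assumes "odd M" "M \<ge> 3" "i \<le> M" "j \<le> M" "table_0_mod_4 M i j = Inl (B h)"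
  shows "i = M \<and> j = 0 \<and> h = M \<or>
    i = M \<and> j < M \<and> odd j \<and> h = j + 1 \<and> h < M \<or>
    j = M \<and> i < M \<and> h < M \<and> odd i \<and> (i = 1 \<and> h = 2 \<or> i \<noteq> 1 \<and> h = i) \<or>
    h = M \<and> i < M \<and> j < M \<and> even i \<and> (j = i + 2 \<or> j + M = i + 2) \<or>
    h < M \<and> i < M \<and> j < M \<and> i \<noteq> j \<and> (2 * h = i + j \<or> 2 * h = i + j + M \<or> 2 * h + M = i + j) \<and>
      (odd j \<longrightarrow> h \<noteq> j + 1) \<and> \<not> (i = 1 \<and> h = 2)"
  using table_0_mod_4_B[OF assms] assms(1,2) by (elim disjE conjE) auto

lemma table_0_mod_4_row_A:
  assumes "odd M" "M \<ge> 3" "i \<le> M" "j \<le> M" "j' \<le> M"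
    "table_0_mod_4 M i j = Inl (A h)" "table_0_mod_4 M i j' = Inl (A h)"
  shows "j = j'"
proof -
  note T = table_0_mod_4_A_cong[OF assms(1-4,6)] table_0_mod_4_A_cong[OF assms(1-3,5,7)]
  consider "i = M" | "i < M" "h = M" | "i < M" "h < M" "h = i + 1 \<or> h + M = i + 1" "even i"
    | "i < M" "h < M" "\<not> ((h = i + 1 \<or> h + M = i + 1) \<and> even i)"
    using assms(3) T(1) by linarith
  then show ?thesis
  proof cases
    case 1 then show ?thesis using T by simp
  next
    case 2 then show ?thesis using T by auto
  next
    case 3 then show ?thesis using T by auto
  next
    case 4
    then have "j < M" "j' < M" "2 * h = i + j \<or> 2 * h = i + j + M \<or> 2 * h + M = i + j"
      "2 * h = i + j' \<or> 2 * h = i + j' + M \<or> 2 * h + M = i + j'" using T by auto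
    then show ?thesis by linarith
  qed
qed

lemma table_0_mod_4_row_B:
  assumes "odd M" "M \<ge> 3" "i \<le> M" "j \<le> M" "j' \<le> M"
    "table_0_mod_4 M i j = Inl (B h)" "table_0_mod_4 M i j' = Inl (B h)"
  shows "j = j'"
proof -
  note T = table_0_mod_4_B_cong[OF assms(1-4,6)] table_0_mod_4_B_cong[OF assms(1-3,5,7)]
  consider "i = M" | "i < M" "h = M" | "i < M" "h < M" "j = M \<or> j' = M" | "i < M" "h < M" "j < M" "j' < M"
    using assms(3-5) T(1) by linarith
  then show ?thesis
  proof cases
    case 1 then show ?thesis using T by auto
  next
    case 2 then show ?thesis using T by auto
  next
    case 3 then show ?thesis using T by auto
  next
    case 4
    then have "2 * h = i + j \<or> 2 * h = i + j + M \<or> 2 * h + M = i + j"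
      "2 * h = i + j' \<or> 2 * h = i + j' + M \<or> 2 * h + M = i + j'" using T by auto
    then show ?thesis using 4 by linarith
  qed
qed

lemma table_0_mod_4_col_A:
  assumes "odd M" "M \<ge> 3" "i \<le> M" "i' \<le> M" "j \<le> M"
    "table_0_mod_4 M i j = Inl (A h)" "table_0_mod_4 M i' j = Inl (A h)"
  shows "i = i'"
proof -
  note T = table_0_mod_4_A_cong[OF assms(1-3,5,6)] table_0_mod_4_A_cong[OF assms(1,2,4,5,7)]
  consider "j = M" | "j < M" "h = M" | "j < M" "h < M" "i = M \<or> i' = M" | "j < M" "h < M" "i < M" "i' < M"
    using assms(3-5) T(1) by linarith
  then show ?thesis
  proof cases
    case 1 then show ?thesis using T by auto
  next
    case 2 then show ?thesis using T by auto
  next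
    case 3 then show ?thesis using T by auto
  next
    case 4
    then have "2 * h = i + j \<or> 2 * h = i + j + M \<or> 2 * h + M = i + j"
      "2 * h = i' + j \<or> 2 * h = i' + j + M \<or> 2 * h + M = i' + j" using T by auto
    then show ?thesis using 4 by linarith
  qed
qed

lemma table_0_mod_4_col_B:
  assumes "odd M" "M \<ge> 3" "i \<le> M" "i' \<le> M" "j \<le> M"
    "table_0_mod_4 M i j = Inl (B h)" "table_0_mod_4 M i' j = Inl (B h)"
  shows "i = i'"
proof -
  note T = table_0_mod_4_B_cong[OF assms(1-3,5,6)] table_0_mod_4_B_cong[OF assms(1,2,4,5,7)]
  consider "j = M" | "j < M" "h = M" | "j < M" "h < M" "i = M \<or> i' = M" | "j < M" "h < M" "i < M" "i' < M"
    using assms(3-5) T(1) by linarith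
  then show ?thesis
  proof cases
    case 1 then show ?thesis using T by auto
  next
    case 2 then show ?thesis using T assms(1) by auto
  next
    case 3 then show ?thesis using T by auto
  next
    case 4
    then have "2 * h = i + j \<or> 2 * h = i + j + M \<or> 2 * h + M = i + j"
      "2 * h = i' + j \<or> 2 * h = i' + j + M \<or> 2 * h + M = i' + j" using T by auto
    then show ?thesis using 4 by linarith
  qed
qed

lemma upper_bound_0_mod_4:
  assumes M: "odd M" "M \<ge> 3"
  shows "harmonious_total_chromatic_number (complete_verts (Suc M + Suc M)) (complete_edges (Suc M + Suc M))
    \<le> Suc M + Suc M + Suc M"
proof (rule table_bound[where M = M and T = "table_0_mod_4 M"])
  fix i j h j' assume "i < Suc M" "j < Suc M" "h < Suc M" "j' < Suc M"
    and "table_0_mod_4 M i j = Inl (A h)" "table_0_mod_4 M h j' = Inl (A i)"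
  then show False
    using M table_0_mod_4_arc_AA[of M i j h] table_0_mod_4_arc_AA[of M h j' i] arc_AA_asym[of M i h]
    by simp
next
  fix i j h i' assume "i < Suc M" "j < Suc M" "i' < Suc M" "h < Suc M"
    and "table_0_mod_4 M i j = Inl (B h)" "table_0_mod_4 M i' h = Inl (B j)"
  then show False
    using M table_0_mod_4_arc_BB[of M i j h] table_0_mod_4_arc_BB[of M i' h j] arc_BB_asym[of M j h]
    by simp
next
  fix i j h i' assume "i < Suc M" "j < Suc M" "i' < Suc M" "h < Suc M"
    and "table_0_mod_4 M i j = Inl (B h)" "table_0_mod_4 M i' h = Inl (A i)"
  then show False
    using M table_0_mod_4_arc_AB[of M i j h] table_0_mod_4_not_arc_AB[of M i' h i] by simp
next
  fix i j h assume ij: "i < Suc M" "j < Suc M" and T: "table_0_mod_4 M i j = Inl (A h)"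
  have "arc_AA M i h" using M ij T table_0_mod_4_arc_AA[of M i j h] by simp
  then have "h \<noteq> i" using M arc_AA_asym[of M i i] by blast
  moreover have "h < Suc M"
    using table_0_mod_4_A_cong[of M i j h] M ij T by auto
  ultimately show "h < Suc M \<and> h \<noteq> i" by simp
next
  fix i j h assume ij: "i < Suc M" "j < Suc M" and T: "table_0_mod_4 M i j = Inl (B h)"
  have "arc_BB M j h" using M ij T table_0_mod_4_arc_BB[of M i j h] by simp
  then have "h \<noteq> j" using M arc_BB_asym[of M j j] by blast
  moreover have "h < Suc M"
    using table_0_mod_4_B_cong[of M i j h] M ij T by auto
  ultimately show "h < Suc M \<and> h \<noteq> j" by simp
next
  fix i j t assume "i < Suc M" "j < Suc M" "table_0_mod_4 M i j = Inr t"
  then have "t = M" by (simp add: table_0_mod_4_Inr)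
  then show "t < Suc M \<and> (\<forall>l<Suc M. l \<noteq> i \<longrightarrow> round_robin M i l \<noteq> t)
      \<and> (\<forall>l<Suc M. l \<noteq> j \<longrightarrow> round_robin M j l \<noteq> t)"
    using round_robin_less[of M] M(1) by (auto simp: less_le)
next
  fix i j j' assume ij: "i < Suc M" "j < Suc M" "j' < Suc M" and eq:
    "table_0_mod_4 M i j = table_0_mod_4 M i j'"
  show "j = j'"
  proof (cases "table_0_mod_4 M i j")
    case (Inr t)
    then show ?thesis using eq table_0_mod_4_Inr[of M i j t] table_0_mod_4_Inr[of M i j' t] by simp
  next
    case (Inl v)
    then show ?thesis
      using M ij eq table_0_mod_4_row_A[of M i j j'] table_0_mod_4_row_B[of M i j j']
      by (cases v) simp_all
  qed
next
  fix i i' j assume ij: "i < Suc M" "i' < Suc M" "j < Suc M" and eq: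
    "table_0_mod_4 M i j = table_0_mod_4 M i' j"
  show "i = i'"
  proof (cases "table_0_mod_4 M i j")
    case (Inr t)
    then show ?thesis using eq table_0_mod_4_Inr[of M i j t] table_0_mod_4_Inr[of M i' j t] by simp
  next
    case (Inl v)
    then show ?thesis
      using M ij eq table_0_mod_4_col_A[of M i i' j] table_0_mod_4_col_B[of M i i' j]
      by (cases v) simp_all
  qed
qed (use M in auto)

section \<open>The harmonious total chromatic number of complete graphs\<close>

lemma lower_bound:
  assumes "n \<ge> 2"
  shows "n + (n + 1) div 2 \<le> harmonious_total_chromatic_number (complete_verts n) (complete_edges n)"
proof (rule harmonious_total_chromatic_number_ge[OF simple_graph_complete])
  fix c :: "nat + nat set \<Rightarrow> nat"
  assume "harmonious_total_colouring (complete_verts n) (complete_edges n) c"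
  then interpret complete_harmonious n c by unfold_locales
  show "n + (n + 1) div 2 \<le> card (c ` (complete_verts n <+> complete_edges n))"
    using card_colours_ge[OF assms] unfolding colours_def .
qed

lemma upper_bound:
  assumes "n \<ge> 2" "n \<noteq> 4"
  shows "harmonious_total_chromatic_number (complete_verts n) (complete_edges n)
    \<le> n + (n + 1) div 2"
proof -
  define k where "k = (n - 1) div 4"
  have "n - 1 = 4 * k \<or> n - 1 = 4 * k + 1 \<or> n - 1 = 4 * k + 2 \<or> n - 1 = 4 * k + 3"
    unfolding k_def by presburger
  then consider "n = 4 * k + 1" | "n = 4 * k + 2" | "n = 4 * k + 3" | "n = 4 * k + 4" "k \<ge> 1"
    using assms(1,2) by linarith
  then show ?thesis
  proof cases
    case 1
    then show ?thesis using upper_bound_1_mod_4[of k] by simp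
  next
    case 2
    then have "n = (2 * k + 1) + (2 * k + 1)" by simp
    then show ?thesis using upper_bound_2_mod_4[of "2 * k + 1"] by simp
  next
    case 3
    then have "n = Suc (2 * k + 1) + (2 * k + 1)" by simp
    then show ?thesis using upper_bound_3_mod_4[of "2 * k + 1"] by simp
  next
    case 4
    then have "Suc (2 * k + 1) + Suc (2 * k + 1) = n" "(n + 1) div 2 = Suc (2 * k + 1)" by simp_all
    then show ?thesis using upper_bound_0_mod_4[of "2 * k + 1"] 4(2) by simp
  qed
qed

lemma ceiling_three_halves: "\<lceil>3 / 2 * real n\<rceil> = int (n + (n + 1) div 2)"
proof (cases "even n")
  case True
  then obtain m where "n = 2 * m" by blast
  then show ?thesis by (simp add: ceiling_eq_iff)
next
  case False
  then obtain m where "n = 2 * m + 1" by (rule oddE)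
  then show ?thesis by (simp add: ceiling_eq_iff)
qed

lemma complete_graph_1:
  "harmonious_total_chromatic_number (complete_verts 1) (complete_edges 1) = 1"
proof (rule antisym)
  have "arc_colouring {0::nat} 0 (\<lambda>x y. Inl x)"
    by (simp add: arc_colouring_def)
  from arc_colouring_bound[OF this, of 1]
  show "harmonious_total_chromatic_number (complete_verts 1) (complete_edges 1) \<le> 1" by simp
  show "1 \<le> harmonious_total_chromatic_number (complete_verts 1) (complete_edges 1)"
  proof (rule harmonious_total_chromatic_number_ge[OF simple_graph_complete])
    fix c :: "nat + nat set \<Rightarrow> nat"
    assume "harmonious_total_colouring (complete_verts 1) (complete_edges 1) c"
    then interpret complete_harmonious 1 c by unfold_locales
    show "1 \<le> card (c ` (complete_verts 1 <+> complete_edges 1))"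
      using card_mono[OF finite_colours vertex_colours_subset] card_vertex_colours unfolding colours_def
      by simp
  qed
qed

lemma complete_graph_4:
  "harmonious_total_chromatic_number (complete_verts 4) (complete_edges 4) = 7"
proof (rule antisym)
  have "arc_colouring {..3::nat} 3 (\<lambda>x y. Inr (round_robin 3 x y))"
    unfolding arc_colouring_def
  proof (intro conjI ballI impI)
    fix x y :: nat
    show "Inr (round_robin 3 x y) = Inr (round_robin 3 y x)" by (simp add: round_robin_commute[of 3 x])
    show "Inr (round_robin 3 x y) \<in> ({..3} - {x}) <+> {..<3}"
      using round_robin_less[of 3 x y] by auto
  next
    fix x y z :: nat
    assume "x \<in> {..3}" "y \<in> {..3}" "z \<in> {..3}" "x \<noteq> y" "x \<noteq> z"
      "Inr (round_robin 3 x y) = Inr (round_robin 3 x z)"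
    then show "y = z" using round_robin_inject[of 3 x y z] by simp
  qed simp
  from arc_colouring_bound[OF this, of 4]
  show "harmonious_total_chromatic_number (complete_verts 4) (complete_edges 4) \<le> 7" by simp
  show "7 \<le> harmonious_total_chromatic_number (complete_verts 4) (complete_edges 4)"
  proof (rule harmonious_total_chromatic_number_ge[OF simple_graph_complete])
    fix c :: "nat + nat set \<Rightarrow> nat"
    assume "harmonious_total_colouring (complete_verts 4) (complete_edges 4) c"
    then interpret complete_harmonious 4 c by unfold_locales
    show "7 \<le> card (c ` (complete_verts 4 <+> complete_edges 4))"
      using card_colours_ge_7 unfolding colours_def by simp
  qed
qed

theorem theorem2:
  fixes n :: nat
  assumes "n \<ge> 1"
  shows "(n \<noteq> 1 \<and> n \<noteq> 4 \<longrightarrow>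
            int (harmonious_total_chromatic_number (complete_verts n) (complete_edges n))
              = \<lceil>3 / 2 * real n\<rceil>) \<and>
         harmonious_total_chromatic_number (complete_verts 1) (complete_edges 1) = 1 \<and>
         harmonious_total_chromatic_number (complete_verts 4) (complete_edges 4) = 7"
proof (intro conjI impI)
  assume n: "n \<noteq> 1 \<and> n \<noteq> 4"
  then have "n \<ge> 2" using assms by simp
  then have "harmonious_total_chromatic_number (complete_verts n) (complete_edges n) = n + (n + 1) div 2"
    using lower_bound upper_bound n by (intro antisym) simp_all
  then show "int (harmonious_total_chromatic_number (complete_verts n) (complete_edges n))
      = \<lceil>3 / 2 * real n\<rceil>"
    by (simp only: ceiling_three_halves)
qed (fact complete_graph_1 complete_graph_4)+

end
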